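(* Let $G$ be a finite group, $m$ a positive integer, and let $N=N_{\mathrm{S}_V}(R(G))$ be the normalizer of $R(G)$ in the symmetric group $\mathrm{S}_V$ on $V=\bigcup_{i=1}^m G_i$. Then $$N=(L_1\times\cdots\times L_m)\rtimes(\mathrm{S}_m\times \mathrm{Aut}(G)),$$ as an internal decomposition of subgroups of $\mathrm{S}_V$.
   Context: $V=\bigcup_{i=1}^m G_i$ is a disjoint union of $m$ copies $G_i=\{x_i: x\in G\}$ of $G$. Permutations act on the right (exponent notation), and products are composed from left to right. $R(G)=\{R(g):g\in G\}$, where $R(g)$ is the permutation $x_i\mapsto (xg)_i$ of $V$ for all $x\in G$, $1\le i\le m$. For $g\in G$ and $1\le i\le m$, $L_i(g)$ is the permutation of $V$ with $x_i\mapsto (g^{-1}x)_i$ and $x_j\mapsto x_j$ for all $x\in G$ and $j\ne i$; $L_i=\{L_i(g):g\in G\}$. The symmetric group $\mathrm{S}_m$ on $\{1,\dots,m\}$ and the automorphism group $\mathrm{Aut}(G)$ are viewed as subgroups of $\mathrm{S}_V$ via $\sigma: x_i\mapsto x_{i^\sigma}$ and $\alpha: x_i\mapsto (x^\alpha)_i$ respectively. *)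

theory Defs
  imports "HOL-Algebra.Algebra"
begin

text \<open>Permutations act on the right, so products are composed from left to right, whereas
  \<^const>\<open>BijGroup\<close>, \<^const>\<open>sym_group\<close> and \<^const>\<open>AutoGroup\<close> multiply by
  ordinary function composition. The right-action versions are the opposite groups.\<close>

definition opp_group :: "('a, 'b) monoid_scheme \<Rightarrow> ('a, 'b) monoid_scheme" where
  "opp_group G = G\<lparr>monoid.mult := \<lambda>x y. y \<otimes>\<^bsub>G\<^esub> x\<rparr>"

definition perm_group :: "'a set \<Rightarrow> ('a \<Rightarrow> 'a) monoid" where
  "perm_group V = opp_group (BijGroup V)"

text \<open>The pair \<open>(x, i)\<close> stands for the element \<open>x\<^sub>i\<close> of the copy \<open>G\<^sub>i\<close>.\<close>

definition copies :: "('a, 'b) monoid_scheme \<Rightarrow> nat \<Rightarrow> ('a \<times> nat) set" where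
  "copies G m = carrier G \<times> {1..m}"

definition R_perm :: "('a, 'b) monoid_scheme \<Rightarrow> nat \<Rightarrow> 'a \<Rightarrow> 'a \<times> nat \<Rightarrow> 'a \<times> nat" where
  "R_perm G m g = (\<lambda>(x, i) \<in> copies G m. (x \<otimes>\<^bsub>G\<^esub> g, i))"

definition R_grp :: "('a, 'b) monoid_scheme \<Rightarrow> nat \<Rightarrow> ('a \<times> nat \<Rightarrow> 'a \<times> nat) set" where
  "R_grp G m = R_perm G m ` carrier G"

definition L_perm :: "('a, 'b) monoid_scheme \<Rightarrow> nat \<Rightarrow> nat \<Rightarrow> 'a \<Rightarrow> 'a \<times> nat \<Rightarrow> 'a \<times> nat" where
  "L_perm G m i g = (\<lambda>(x, j) \<in> copies G m. if j = i then (inv\<^bsub>G\<^esub> g \<otimes>\<^bsub>G\<^esub> x, j) else (x, j))"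

definition L_grp :: "('a, 'b) monoid_scheme \<Rightarrow> nat \<Rightarrow> nat \<Rightarrow> ('a \<times> nat \<Rightarrow> 'a \<times> nat) set" where
  "L_grp G m i = L_perm G m i ` carrier G"

definition sym_perm :: "('a, 'b) monoid_scheme \<Rightarrow> nat \<Rightarrow> (nat \<Rightarrow> nat) \<Rightarrow> 'a \<times> nat \<Rightarrow> 'a \<times> nat" where
  "sym_perm G m \<sigma> = (\<lambda>(x, i) \<in> copies G m. (x, \<sigma> i))"

definition sym_grp :: "('a, 'b) monoid_scheme \<Rightarrow> nat \<Rightarrow> ('a \<times> nat \<Rightarrow> 'a \<times> nat) set" where
  "sym_grp G m = sym_perm G m ` carrier (sym_group m)"

definition aut_perm :: "('a, 'b) monoid_scheme \<Rightarrow> nat \<Rightarrow> ('a \<Rightarrow> 'a) \<Rightarrow> 'a \<times> nat \<Rightarrow> 'a \<times> nat" where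
  "aut_perm G m \<alpha> = (\<lambda>(x, i) \<in> copies G m. (\<alpha> x, i))"

definition aut_grp :: "('a, 'b) monoid_scheme \<Rightarrow> nat \<Rightarrow> ('a \<times> nat \<Rightarrow> 'a \<times> nat) set" where
  "aut_grp G m = aut_perm G m ` carrier (AutoGroup G)"

text \<open>Internal products of subgroups of \<open>S\<close>; the subgroup \<open>P\<close> is the product.\<close>

definition internal_semidirect :: "('a, 'b) monoid_scheme \<Rightarrow> 'a set \<Rightarrow> 'a set \<Rightarrow> 'a set \<Rightarrow> bool" where
  "internal_semidirect S A B P \<longleftrightarrow>
     subgroup P S \<and> A \<lhd> S\<lparr>carrier := P\<rparr> \<and> subgroup B (S\<lparr>carrier := P\<rparr>) \<and>
     A \<inter> B = {\<one>\<^bsub>S\<^esub>} \<and> P = A <#>\<^bsub>S\<^esub> B"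

definition internal_direct :: "('a, 'b) monoid_scheme \<Rightarrow> 'a set \<Rightarrow> 'a set \<Rightarrow> 'a set \<Rightarrow> bool" where
  "internal_direct S A B P \<longleftrightarrow>
     subgroup P S \<and> A \<lhd> S\<lparr>carrier := P\<rparr> \<and> B \<lhd> S\<lparr>carrier := P\<rparr> \<and>
     A \<inter> B = {\<one>\<^bsub>S\<^esub>} \<and> P = A <#>\<^bsub>S\<^esub> B"

definition internal_direct_family ::
    "('a, 'b) monoid_scheme \<Rightarrow> 'i set \<Rightarrow> ('i \<Rightarrow> 'a set) \<Rightarrow> 'a set \<Rightarrow> bool" where
  "internal_direct_family S I H P \<longleftrightarrow>
     subgroup P S \<and> (\<forall>i\<in>I. H i \<lhd> S\<lparr>carrier := P\<rparr>) \<and>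
     (\<forall>i\<in>I. H i \<inter> generate S (\<Union>j\<in>I - {i}. H j) = {\<one>\<^bsub>S\<^esub>}) \<and>
     P = generate S (\<Union>i\<in>I. H i)"

text \<open>The remaining facts justify regarding \<open>G\<close>, the symmetric group and the automorphism group
  as subgroups of the permutation group of the copies: all the maps above are injective
  homomorphisms for the left-to-right products.\<close>

lemma opp_group_simps [simp]:
  "carrier (opp_group G) = carrier G" "\<one>\<^bsub>opp_group G\<^esub> = \<one>\<^bsub>G\<^esub>"
  "x \<otimes>\<^bsub>opp_group G\<^esub> y = y \<otimes>\<^bsub>G\<^esub> x"
  by (simp_all add: opp_group_def)

lemma group_opp_group:
  assumes "group G" shows "group (opp_group G)"
proof -
  interpret group G by fact
  show ?thesis
  proof (rule groupI)
    fix x assume "x \<in> carrier (opp_group G)"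
    then show "\<exists>y\<in>carrier (opp_group G). y \<otimes>\<^bsub>opp_group G\<^esub> x = \<one>\<^bsub>opp_group G\<^esub>"
      by (auto intro: bexI [of _ "inv\<^bsub>G\<^esub> x"])
  qed (auto simp: m_assoc)
qed

lemma group_perm_group: "group (perm_group V)"
  by (simp add: perm_group_def group_opp_group group_BijGroup)

lemma carrier_perm_group [simp]: "carrier (perm_group V) = Bij V"
  by (simp add: perm_group_def BijGroup_def)

lemma one_perm_group [simp]: "\<one>\<^bsub>perm_group V\<^esub> = (\<lambda>x\<in>V. x)"
  by (simp add: perm_group_def BijGroup_def)

lemma mult_perm_group [simp]:
  "f \<in> Bij V \<Longrightarrow> g \<in> Bij V \<Longrightarrow> f \<otimes>\<^bsub>perm_group V\<^esub> g = compose V g f"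
  by (simp add: perm_group_def BijGroup_def)

lemma mem_copies [simp]: "(x, i) \<in> copies G m \<longleftrightarrow> x \<in> carrier G \<and> i \<in> {1..m}"
  by (simp add: copies_def)

lemma Bij_restrictI:
  assumes "\<And>x. x \<in> V \<Longrightarrow> f x \<in> V" "\<And>x. x \<in> V \<Longrightarrow> g x \<in> V"
    "\<And>x. x \<in> V \<Longrightarrow> g (f x) = x" "\<And>x. x \<in> V \<Longrightarrow> f (g x) = x"
  shows "restrict f V \<in> Bij V"
proof -
  have "bij_betw f V V"
    by (rule bij_betw_byWitness [where f' = g]) (use assms in auto)
  then show ?thesis
    by (simp add: Bij_def)
qed

lemma R_perm_Bij:
  assumes "group G" "g \<in> carrier G" shows "R_perm G m g \<in> Bij (copies G m)"
proof -
  interpret group G by fact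
  show ?thesis
    unfolding R_perm_def
    by (rule Bij_restrictI [where g = "\<lambda>(x, i). (x \<otimes>\<^bsub>G\<^esub> inv\<^bsub>G\<^esub> g, i)"])
      (use assms in \<open>auto simp: copies_def m_assoc\<close>)
qed

lemma L_perm_Bij:
  assumes "group G" "g \<in> carrier G" shows "L_perm G m i g \<in> Bij (copies G m)"
proof -
  interpret group G by fact
  show ?thesis
    unfolding L_perm_def
    by (rule Bij_restrictI [where g = "\<lambda>(x, j). if j = i then (g \<otimes>\<^bsub>G\<^esub> x, j) else (x, j)"])
      (use assms in \<open>auto simp: copies_def m_assoc [symmetric]\<close>)
qed

lemma sym_perm_Bij:
  assumes "\<sigma> \<in> carrier (sym_group m)" shows "sym_perm G m \<sigma> \<in> Bij (copies G m)"
proof -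
  have s: "\<sigma> permutes {1..m}" using assms by (simp add: sym_group_carrier)
  show ?thesis
    unfolding sym_perm_def
    by (rule Bij_restrictI [where g = "\<lambda>(x, i). (x, Hilbert_Choice.inv \<sigma> i)"])
      (use permutes_in_image [OF s] permutes_in_image [OF permutes_inv [OF s]]
          permutes_inverses [OF s] in \<open>auto simp: copies_def simp del: atLeastAtMost_iff\<close>)
qed

lemma aut_perm_Bij:
  assumes "\<alpha> \<in> carrier (AutoGroup G)" shows "aut_perm G m \<alpha> \<in> Bij (copies G m)"
proof -
  have b: "bij_betw \<alpha> (carrier G) (carrier G)"
    using assms by (simp add: AutoGroup_def auto_def Bij_def)
  show ?thesis
    unfolding aut_perm_def
    by (rule Bij_restrictI [where g = "\<lambda>(x, i). (inv_into (carrier G) \<alpha> x, i)"])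
      (use b bij_betw_inv_into [OF b] in \<open>auto simp: copies_def bij_betw_inv_into_left
          bij_betw_inv_into_right dest: bij_betwE\<close>)
qed

lemma R_perm_hom:
  assumes "group G" shows "R_perm G m \<in> hom G (perm_group (copies G m))"
proof -
  interpret group G by fact
  show ?thesis
    by (rule homI; simp add: R_perm_Bij [OF assms])
      (auto simp: fun_eq_iff compose_def R_perm_def m_assoc)
qed

lemma L_perm_hom:
  assumes "group G" shows "L_perm G m i \<in> hom G (perm_group (copies G m))"
proof -
  interpret group G by fact
  show ?thesis
    by (rule homI; simp add: L_perm_Bij [OF assms])
      (auto simp: fun_eq_iff compose_def L_perm_def m_assoc inv_mult_group)
qed

lemma sym_perm_hom: "sym_perm G m \<in> hom (opp_group (sym_group m)) (perm_group (copies G m))"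
proof (rule homI)
  fix \<sigma> \<tau> assume s: "\<sigma> \<in> carrier (opp_group (sym_group m))" "\<tau> \<in> carrier (opp_group (sym_group m))"
  then have "\<sigma> i \<in> {1..m}" if "i \<in> {1..m}" for i
    using that permutes_in_image [of \<sigma> "{1..m}" i] by (simp add: sym_group_carrier)
  with s show "sym_perm G m (\<sigma> \<otimes>\<^bsub>opp_group (sym_group m)\<^esub> \<tau>) =
      sym_perm G m \<sigma> \<otimes>\<^bsub>perm_group (copies G m)\<^esub> sym_perm G m \<tau>"
    by (simp add: sym_perm_Bij sym_group_mult)
      (auto simp: fun_eq_iff compose_def sym_perm_def)
qed (simp add: sym_perm_Bij)

lemma aut_perm_hom: "aut_perm G m \<in> hom (opp_group (AutoGroup G)) (perm_group (copies G m))"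
proof (rule homI)
  fix \<alpha> \<beta> assume s: "\<alpha> \<in> carrier (opp_group (AutoGroup G))" "\<beta> \<in> carrier (opp_group (AutoGroup G))"
  then have "\<alpha> \<in> Bij (carrier G)" "\<beta> \<in> Bij (carrier G)"
    by (simp_all add: AutoGroup_def auto_def)
  moreover from this have "\<alpha> x \<in> carrier G" if "x \<in> carrier G" for x
    using that Bij_imp_funcset by blast
  ultimately show "aut_perm G m (\<alpha> \<otimes>\<^bsub>opp_group (AutoGroup G)\<^esub> \<beta>) =
      aut_perm G m \<alpha> \<otimes>\<^bsub>perm_group (copies G m)\<^esub> aut_perm G m \<beta>"
    using s by (simp add: aut_perm_Bij)
      (auto simp: fun_eq_iff compose_def aut_perm_def AutoGroup_def BijGroup_def)
qed (simp add: aut_perm_Bij)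

lemma R_perm_inj:
  assumes "group G" "m \<ge> 1" shows "inj_on (R_perm G m) (carrier G)"
proof (rule inj_onI)
  interpret group G by fact
  fix g h assume gh: "g \<in> carrier G" "h \<in> carrier G" "R_perm G m g = R_perm G m h"
  show "g = h"
    using gh(1,2) assms(2) fun_cong [OF gh(3), of "(\<one>\<^bsub>G\<^esub>, 1)"] by (simp add: R_perm_def copies_def)
qed

lemma L_perm_inj:
  assumes "group G" "i \<in> {1..m}" shows "inj_on (L_perm G m i) (carrier G)"
proof (rule inj_onI)
  interpret group G by fact
  fix g h assume gh: "g \<in> carrier G" "h \<in> carrier G" "L_perm G m i g = L_perm G m i h"
  have "inv\<^bsub>G\<^esub> g = inv\<^bsub>G\<^esub> h"
    using gh(1,2) assms(2) fun_cong [OF gh(3), of "(\<one>\<^bsub>G\<^esub>, i)"] by (simp add: L_perm_def copies_def)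
  then show "g = h"
    using gh by (metis inv_inv)
qed

lemma sym_perm_inj:
  assumes "group G" shows "inj_on (sym_perm G m) (carrier (sym_group m))"
proof (rule inj_onI)
  interpret group G by fact
  fix \<sigma> \<tau> assume s: "\<sigma> \<in> carrier (sym_group m)" "\<tau> \<in> carrier (sym_group m)"
    "sym_perm G m \<sigma> = sym_perm G m \<tau>"
  show "\<sigma> = \<tau>"
  proof
    fix i
    show "\<sigma> i = \<tau> i"
    proof (cases "i \<in> {1..m}")
      case True
      then show ?thesis
        using fun_cong [OF s(3), of "(\<one>\<^bsub>G\<^esub>, i)"] by (simp add: sym_perm_def copies_def)
    next
      case False
      then show ?thesis
        using s(1,2) unfolding sym_group_carrier by (metis permutes_not_in)
    qed
  qed
qed

lemma aut_perm_inj: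
  assumes "m \<ge> 1" shows "inj_on (aut_perm G m) (carrier (AutoGroup G))"
proof (rule inj_onI)
  fix \<alpha> \<beta> assume s: "\<alpha> \<in> carrier (AutoGroup G)" "\<beta> \<in> carrier (AutoGroup G)"
    "aut_perm G m \<alpha> = aut_perm G m \<beta>"
  have "\<alpha> x = \<beta> x" if "x \<in> carrier G" for x
    using fun_cong [OF s(3), of "(x, 1)"] that assms by (simp add: aut_perm_def copies_def)
  then show "\<alpha> = \<beta>"
    using s(1,2) by (auto simp: AutoGroup_def auto_def Bij_def intro: extensionalityI)
qed

end

theory Submission
  imports Defs
begin

text \<open>
  Let \<open>f\<close> normalize the right translations \<open>R\<close>. Then \<open>R(g) f = f R(\<alpha> g)\<close> for a map \<open>\<alpha>\<close>
  from \<open>G\<close> to \<open>G\<close>, which is an automorphism. Evaluating this identity at the neutral element \<open>1\<^sub>i\<close>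
  of the \<open>i\<close>-th copy shows that \<open>f\<close> is determined by \<open>\<alpha>\<close> and the points \<open>f(1\<^sub>i)\<close>: if
  \<open>f(1\<^sub>i) = (p\<^sub>i, \<sigma> i)\<close>, then \<open>f(x, i) = (p\<^sub>i \<cdot> \<alpha> x, \<sigma> i)\<close>. As \<open>f\<close> is onto, so is \<open>\<sigma>\<close>, hence \<open>\<sigma>\<close> is a
  permutation of the finite index set. Writing \<open>p\<^sub>i = \<alpha> c\<^sub>i\<close>, such an \<open>f\<close> is the left
  translation of every copy \<open>i\<close> by \<open>c\<^sub>i\<close>, followed by \<open>\<sigma>\<close> on the indices and \<open>\<alpha>\<close> on the group
  elements (lemma \<open>normalizer_R_grp_decomposition\<close>). Conversely, left translations and index
  permutations commute with \<open>R\<close>, and automorphisms permute it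
  (lemma \<open>shift_twist_mem_normalizer\<close>).

  Two observations turn this factorization into internal products. First, a permutation that
  translates each copy from the left is described by a family \<open>c\<close> of group elements, and the subgroup
  generated by the \<open>L\<^sub>j\<close> with \<open>j \<in> J\<close> consists of the families supported on \<open>J\<close>
  (lemma \<open>generate_L_grp\<close>); independence of the \<open>L\<^sub>i\<close> is then the disjointness of supports. Secondly,
  moving \<open>\<sigma>\<close> and \<open>\<alpha>\<close> past the translation by \<open>d\<close> yields the translation by
  \<open>i \<mapsto> \<alpha>\<^sup>-\<^sup>1 (d (\<sigma> i))\<close> (lemma \<open>twist_shift_exchange\<close>), so the left translations are normalized by
  the symmetric and the automorphism group.
\<close>

section \<open>Criteria for normalizers and internal products\<close>

lemma (in group) mem_normalizer_iff:
  assumes "H \<subseteq> carrier G"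
  shows "f \<in> normalizer G H \<longleftrightarrow> f \<in> carrier G \<and> f <# H = H #> f"
proof -
  have "f <# H #> inv f = H \<longleftrightarrow> f <# H = H #> f" if f: "f \<in> carrier G"
  proof
    assume "f <# H #> inv f = H"
    then have "f <# H #> inv f #> f = H #> f" by simp
    then show "f <# H = H #> f"
      using f assms by (simp add: coset_mult_assoc l_coset_subset_G)
  next
    assume "f <# H = H #> f"
    then show "f <# H #> inv f = H"
      using f assms by (simp add: coset_mult_assoc)
  qed
  then show ?thesis
    using assms by (auto simp: normalizer_def stabilizer_def)
qed

text \<open>Normality is tested by moving an element past another one, so that no inverse in the
  ambient group has to be computed. For permutations this is an identity between two
  compositions, which can be checked point by point.\<close>

lemma (in group) normal_of_exchange:
  assumes P: "subgroup P G" and A: "subgroup A G" "A \<subseteq> P"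
    and ex: "\<And>f a. f \<in> P \<Longrightarrow> a \<in> A \<Longrightarrow> \<exists>a'\<in>A. f \<otimes> a = a' \<otimes> f"
  shows "A \<lhd> G\<lparr>carrier := P\<rparr>"
proof (rule group.normal_invI [OF subgroup_imp_group [OF P]])
  show "subgroup A (G\<lparr>carrier := P\<rparr>)"
    by (rule subgroup_incl [OF A(1) P A(2)])
  fix f a assume f: "f \<in> carrier (G\<lparr>carrier := P\<rparr>)" and a: "a \<in> A"
  have f': "f \<in> P" "f \<in> carrier G" using f subgroup.subset [OF P] by auto
  obtain a' where a': "a' \<in> A" "f \<otimes> a = a' \<otimes> f" using ex f'(1) a by blast
  then have "f \<otimes> a \<otimes> inv f = a'"
    using f' subgroup.mem_carrier [OF A(1)] by (simp add: m_assoc)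
  with a' f' P show "f \<otimes>\<^bsub>G\<lparr>carrier := P\<rparr>\<^esub> a \<otimes>\<^bsub>G\<lparr>carrier := P\<rparr>\<^esub> inv\<^bsub>G\<lparr>carrier := P\<rparr>\<^esub> f \<in> A"
    by (simp add: m_inv_consistent)
qed

lemma mem_set_mult: "x \<in> A <#>\<^bsub>G\<^esub> B \<longleftrightarrow> (\<exists>a\<in>A. \<exists>b\<in>B. x = a \<otimes>\<^bsub>G\<^esub> b)"
  by (simp add: set_mult_def)

text \<open>The exchange of \<open>b\<close> with \<open>a\<close> rewrites \<open>a b c d\<close> as \<open>(a c') (b d)\<close>, so that the product set is
  closed under multiplication; conjugation by \<open>b\<close> preserves \<open>A\<close> by the same exchange and
  conjugation by elements of \<open>A\<close> does so trivially.\<close>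

lemma (in group) internal_semidirectI:
  assumes A: "subgroup A G" and B: "subgroup B G" and triv: "A \<inter> B \<subseteq> {\<one>}"
    and ex: "\<And>a b. a \<in> A \<Longrightarrow> b \<in> B \<Longrightarrow> \<exists>a'\<in>A. b \<otimes> a = a' \<otimes> b"
  shows "internal_semidirect G A B (A <#> B)"
proof -
  interpret A: subgroup A G by fact
  interpret B: subgroup B G by fact
  have AB: "a \<otimes> b \<in> A <#> B" if "a \<in> A" "b \<in> B" for a b
    using that by (auto simp: set_mult_def)
  have P: "subgroup (A <#> B) G"
  proof (rule subgroupI)
    show "A <#> B \<subseteq> carrier G"
      by (rule set_mult_closed [OF A.subset B.subset])
    show "A <#> B \<noteq> {}"
      using AB [OF A.one_closed B.one_closed] by (rule contrapos_pn) simp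
    fix x assume "x \<in> A <#> B"
    then obtain a b where ab: "a \<in> A" "b \<in> B" "x = a \<otimes> b" by (auto simp: set_mult_def)
    obtain a' where a': "a' \<in> A" "inv b \<otimes> inv a = a' \<otimes> inv b" using ex ab by blast
    then show "inv x \<in> A <#> B"
      using ab by (auto simp: set_mult_def inv_mult_group)
    fix y assume "y \<in> A <#> B"
    then obtain c d where cd: "c \<in> A" "d \<in> B" "y = c \<otimes> d" by (auto simp: set_mult_def)
    obtain c' where c': "c' \<in> A" "b \<otimes> c = c' \<otimes> b" using ex ab cd by blast
    have "x \<otimes> y = a \<otimes> (b \<otimes> c) \<otimes> d" using ab cd by (simp add: m_assoc)
    also have "\<dots> = (a \<otimes> c') \<otimes> (b \<otimes> d)" using ab cd c' by (simp add: m_assoc)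
    finally show "x \<otimes> y \<in> A <#> B"
      using ab cd c' by (auto simp: set_mult_def)
  qed
  have AP: "A \<subseteq> A <#> B"
    using AB [OF _ B.one_closed] by (auto simp: A.mem_carrier)
  have BP: "B \<subseteq> A <#> B"
    using AB [OF A.one_closed] by (auto simp: B.mem_carrier)
  have "A \<lhd> G\<lparr>carrier := A <#> B\<rparr>"
  proof (rule normal_of_exchange [OF P A AP])
    fix f a assume "f \<in> A <#> B" and a: "a \<in> A"
    then obtain c b where cb: "c \<in> A" "b \<in> B" "f = c \<otimes> b" by (auto simp: set_mult_def)
    obtain a' where a': "a' \<in> A" "b \<otimes> a = a' \<otimes> b" using ex cb a by blast
    have "f \<otimes> a = c \<otimes> (a' \<otimes> b)" using cb a a' by (simp add: m_assoc)
    also have "\<dots> = (c \<otimes> a' \<otimes> inv c) \<otimes> f"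
      using cb a' by (simp add: m_assoc inv_solve_left)
    finally show "\<exists>a'\<in>A. f \<otimes> a = a' \<otimes> f" using cb a' by blast
  qed
  then show ?thesis
    using P triv subgroup_incl [OF B P BP] by (auto simp: internal_semidirect_def)
qed

text \<open>If \<open>A\<close> and \<open>B\<close> commute elementwise, the product is semidirect in both orders.\<close>

lemma (in group) internal_directI:
  assumes A: "subgroup A G" and B: "subgroup B G" and triv: "A \<inter> B \<subseteq> {\<one>}"
    and comm: "\<And>a b. a \<in> A \<Longrightarrow> b \<in> B \<Longrightarrow> a \<otimes> b = b \<otimes> a"
  shows "internal_direct G A B (A <#> B)"
proof -
  have "internal_semidirect G A B (A <#> B)"
    by (rule internal_semidirectI [OF A B triv]) (use comm in auto)
  moreover have "internal_semidirect G B A (B <#> A)"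
    by (rule internal_semidirectI [OF B A]) (use comm triv in auto)
  moreover have "B <#> A = A <#> B"
    using comm by (force simp: set_mult_def)
  ultimately show ?thesis
    by (simp add: internal_semidirect_def internal_direct_def)
qed

section \<open>Permutations of the copies\<close>

lemma perm_mult_apply:
  assumes "f \<in> Bij V" "g \<in> Bij V" "v \<in> V"
  shows "(f \<otimes>\<^bsub>perm_group V\<^esub> g) v = g (f v)"
  using assms by (simp add: compose_def)

lemma perm_mult_Bij:
  assumes "f \<in> Bij V" "g \<in> Bij V"
  shows "f \<otimes>\<^bsub>perm_group V\<^esub> g \<in> Bij V"
  using assms by (simp add: compose_Bij)

lemma perm_eqI:
  assumes "f \<in> Bij V" "g \<in> Bij V" "\<And>v. v \<in> V \<Longrightarrow> f v = g v"
  shows "f = g"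
  using assms by (meson Bij_imp_extensional extensionalityI)

lemma copies_perm_eqI:
  assumes "f \<in> Bij (copies G m)" "g \<in> Bij (copies G m)"
    "\<And>x i. x \<in> carrier G \<Longrightarrow> i \<in> {1..m} \<Longrightarrow> f (x, i) = g (x, i)"
  shows "f = g"
  by (rule perm_eqI [OF assms(1,2)]) (use assms(3) in \<open>auto simp: copies_def\<close>)

lemma R_perm_apply: "x \<in> carrier G \<Longrightarrow> i \<in> {1..m} \<Longrightarrow> R_perm G m g (x, i) = (x \<otimes>\<^bsub>G\<^esub> g, i)"
  by (simp add: R_perm_def)

lemma sym_perm_apply: "x \<in> carrier G \<Longrightarrow> i \<in> {1..m} \<Longrightarrow> sym_perm G m \<sigma> (x, i) = (x, \<sigma> i)"
  by (simp add: sym_perm_def)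

lemma aut_perm_apply: "x \<in> carrier G \<Longrightarrow> i \<in> {1..m} \<Longrightarrow> aut_perm G m \<alpha> (x, i) = (\<alpha> x, i)"
  by (simp add: aut_perm_def)

lemma sym_group_index:
  "\<sigma> \<in> carrier (sym_group m) \<Longrightarrow> i \<in> {1..m} \<Longrightarrow> \<sigma> i \<in> {1..m}"
  unfolding sym_group_carrier by (meson permutes_in_image)

lemma carrier_AutoGroup: "carrier (AutoGroup G) = hom G G \<inter> Bij (carrier G)"
  by (simp add: AutoGroup_def auto_def)

lemma automorphism_closed:
  "\<alpha> \<in> carrier (AutoGroup G) \<Longrightarrow> x \<in> carrier G \<Longrightarrow> \<alpha> x \<in> carrier G"
  by (auto simp: carrier_AutoGroup hom_def)

lemma automorphism_mult:
  "\<alpha> \<in> carrier (AutoGroup G) \<Longrightarrow> x \<in> carrier G \<Longrightarrow> y \<in> carrier G \<Longrightarrow>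
    \<alpha> (x \<otimes>\<^bsub>G\<^esub> y) = \<alpha> x \<otimes>\<^bsub>G\<^esub> \<alpha> y"
  by (auto simp: carrier_AutoGroup hom_def)

lemma automorphism_surj:
  assumes "\<alpha> \<in> carrier (AutoGroup G)" "y \<in> carrier G"
  shows "\<exists>x. x \<in> carrier G \<and> \<alpha> x = y"
proof -
  have "\<alpha> ` carrier G = carrier G"
    using assms(1) by (simp add: carrier_AutoGroup Bij_def bij_betw_def)
  with assms(2) have "y \<in> \<alpha> ` carrier G" by simp
  then show ?thesis by blast
qed

lemma (in group) automorphism_one:
  assumes "\<alpha> \<in> carrier (AutoGroup G)" shows "\<alpha> \<one> = \<one>"
  using assms hom_one [of \<alpha> G] is_group by (auto simp: carrier_AutoGroup)

lemma (in group) subgroup_sym_grp: "subgroup (sym_grp G m) (perm_group (copies G m))"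
proof -
  interpret group_hom "opp_group (sym_group m)" "perm_group (copies G m)" "sym_perm G m"
    by (simp add: group_hom_def group_hom_axioms_def group_opp_group sym_group_is_group
        group_perm_group sym_perm_hom)
  show ?thesis using img_is_subgroup by (simp add: sym_grp_def)
qed

lemma (in group) subgroup_aut_grp: "subgroup (aut_grp G m) (perm_group (copies G m))"
proof -
  interpret group_hom "opp_group (AutoGroup G)" "perm_group (copies G m)" "aut_perm G m"
    by (simp add: group_hom_def group_hom_axioms_def group_opp_group AutoGroup
        group_perm_group aut_perm_hom)
  show ?thesis using img_is_subgroup by (simp add: aut_grp_def)
qed

section \<open>The product of the left translation groups\<close>

definition shift_perm :: "('a, 'b) monoid_scheme \<Rightarrow> nat \<Rightarrow> (nat \<Rightarrow> 'a) \<Rightarrow> 'a \<times> nat \<Rightarrow> 'a \<times> nat" where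
  "shift_perm G m c = (\<lambda>(x, i) \<in> copies G m. (c i \<otimes>\<^bsub>G\<^esub> x, i))"

text \<open>Families are total functions that are trivial outside \<open>J\<close>. For \<open>J \<subseteq> {1..m}\<close> the value of a
  family outside the index range is thereby fixed, so that a translation determines its family.\<close>

definition supported :: "('a, 'b) monoid_scheme \<Rightarrow> nat set \<Rightarrow> (nat \<Rightarrow> 'a) set" where
  "supported G J = {c. (\<forall>i. c i \<in> carrier G) \<and> (\<forall>i. i \<notin> J \<longrightarrow> c i = \<one>\<^bsub>G\<^esub>)}"

definition shift_grp :: "('a, 'b) monoid_scheme \<Rightarrow> nat \<Rightarrow> nat set \<Rightarrow> ('a \<times> nat \<Rightarrow> 'a \<times> nat) set" where
  "shift_grp G m J = shift_perm G m ` supported G J"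

lemma supported_mono: "I \<subseteq> J \<Longrightarrow> supported G I \<subseteq> supported G J"
  unfolding supported_def by blast

lemma shift_perm_apply:
  "x \<in> carrier G \<Longrightarrow> i \<in> {1..m} \<Longrightarrow> shift_perm G m c (x, i) = (c i \<otimes>\<^bsub>G\<^esub> x, i)"
  by (simp add: shift_perm_def)

lemma (in group) shift_perm_Bij:
  assumes "c \<in> supported G J" shows "shift_perm G m c \<in> Bij (copies G m)"
proof -
  have "c i \<in> carrier G" for i using assms by (simp add: supported_def)
  then show ?thesis
    unfolding shift_perm_def
    by (intro Bij_restrictI [where g = "\<lambda>(x, i). (inv (c i) \<otimes> x, i)"])
      (auto simp: copies_def m_assoc [symmetric])
qed

lemma (in group) shift_perm_mult:
  assumes "c \<in> supported G I" "d \<in> supported G J"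
  shows "shift_perm G m c \<otimes>\<^bsub>perm_group (copies G m)\<^esub> shift_perm G m d =
    shift_perm G m (\<lambda>i. d i \<otimes> c i)"
proof (rule copies_perm_eqI)
  have cd: "c i \<in> carrier G" "d i \<in> carrier G" for i using assms by (simp_all add: supported_def)
  then have "(\<lambda>i. d i \<otimes> c i) \<in> supported G UNIV" by (simp add: supported_def)
  then show "shift_perm G m (\<lambda>i. d i \<otimes> c i) \<in> Bij (copies G m)" by (rule shift_perm_Bij)
  show "shift_perm G m c \<otimes>\<^bsub>perm_group (copies G m)\<^esub> shift_perm G m d \<in> Bij (copies G m)"
    by (intro perm_mult_Bij shift_perm_Bij [OF assms(1)] shift_perm_Bij [OF assms(2)])
  fix x i assume "x \<in> carrier G" "i \<in> {1..m}"
  with cd show "(shift_perm G m c \<otimes>\<^bsub>perm_group (copies G m)\<^esub> shift_perm G m d) (x, i) =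
      shift_perm G m (\<lambda>i. d i \<otimes> c i) (x, i)"
    by (simp add: perm_mult_apply shift_perm_Bij [OF assms(1)] shift_perm_Bij [OF assms(2)]
        shift_perm_apply m_assoc del: mult_perm_group)
qed

lemma (in group) shift_perm_one: "shift_perm G m (\<lambda>_. \<one>) = \<one>\<^bsub>perm_group (copies G m)\<^esub>"
  by (auto simp: fun_eq_iff shift_perm_def)

lemma (in group) shift_perm_inv:
  assumes "c \<in> supported G J"
  shows "inv\<^bsub>perm_group (copies G m)\<^esub> (shift_perm G m c) = shift_perm G m (\<lambda>i. inv (c i))"
proof -
  have c: "c i \<in> carrier G" for i using assms by (simp add: supported_def)
  then have d: "(\<lambda>i. inv (c i)) \<in> supported G UNIV" by (simp add: supported_def)
  have "shift_perm G m (\<lambda>i. inv (c i)) \<otimes>\<^bsub>perm_group (copies G m)\<^esub> shift_perm G m c =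
      \<one>\<^bsub>perm_group (copies G m)\<^esub>"
    by (simp add: shift_perm_mult [OF d assms] shift_perm_one [symmetric] c del: mult_perm_group one_perm_group)
  then show ?thesis
    by (intro group.inv_equality group_perm_group)
      (simp_all add: shift_perm_Bij [OF assms] shift_perm_Bij [OF d])
qed

lemma (in group) subgroup_shift_grp: "subgroup (shift_grp G m J) (perm_group (copies G m))"
proof (rule group.subgroupI [OF group_perm_group])
  show "shift_grp G m J \<subseteq> carrier (perm_group (copies G m))"
    by (auto simp: shift_grp_def shift_perm_Bij)
  have "(\<lambda>_. \<one>) \<in> supported G J" by (simp add: supported_def)
  then show "shift_grp G m J \<noteq> {}" by (auto simp: shift_grp_def)
  fix f assume "f \<in> shift_grp G m J"
  then obtain c where c: "c \<in> supported G J" "f = shift_perm G m c" by (auto simp: shift_grp_def)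
  then have "(\<lambda>i. inv (c i)) \<in> supported G J" by (auto simp: supported_def)
  then show "inv\<^bsub>perm_group (copies G m)\<^esub> f \<in> shift_grp G m J"
    using c by (simp add: shift_perm_inv shift_grp_def)
  fix h assume "h \<in> shift_grp G m J"
  then obtain d where d: "d \<in> supported G J" "h = shift_perm G m d" by (auto simp: shift_grp_def)
  then have "(\<lambda>i. d i \<otimes> c i) \<in> supported G J" using c by (auto simp: supported_def)
  then show "f \<otimes>\<^bsub>perm_group (copies G m)\<^esub> h \<in> shift_grp G m J"
    using c d by (simp add: shift_perm_mult shift_grp_def del: mult_perm_group)
qed

text \<open>Since \<open>L_perm\<close> multiplies by the inverse of its argument from the left, the family of
  \<open>L_perm G m i g\<close> has the entry \<open>inv g\<close> at \<open>i\<close>.\<close>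

lemma (in group) L_grp_eq_shift_grp: "L_grp G m i = shift_grp G m {i}"
proof
  show "L_grp G m i \<subseteq> shift_grp G m {i}"
  proof
    fix f assume "f \<in> L_grp G m i"
    then obtain g where g: "g \<in> carrier G" "f = L_perm G m i g" by (auto simp: L_grp_def)
    have "f = shift_perm G m (\<lambda>j. if j = i then inv g else \<one>)"
      using g by (auto simp: fun_eq_iff L_perm_def shift_perm_def)
    moreover have "(\<lambda>j. if j = i then inv g else \<one>) \<in> supported G {i}"
      using g by (simp add: supported_def)
    ultimately show "f \<in> shift_grp G m {i}" by (simp add: shift_grp_def)
  qed
  show "shift_grp G m {i} \<subseteq> L_grp G m i"
  proof
    fix f assume "f \<in> shift_grp G m {i}"
    then obtain c where c: "c \<in> supported G {i}" "f = shift_perm G m c" by (auto simp: shift_grp_def)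
    then have "f = L_perm G m i (inv (c i))"
      by (auto simp: fun_eq_iff L_perm_def shift_perm_def supported_def)
    moreover have "inv (c i) \<in> carrier G" using c by (simp add: supported_def)
    ultimately show "f \<in> L_grp G m i" by (simp add: L_grp_def)
  qed
qed

text \<open>A family supported on \<open>J\<close> is split off one entry at a time, and a one-entry family belongs to
  one of the groups \<open>L\<^sub>j\<close>.\<close>

lemma (in group) generate_L_grp:
  assumes "finite J"
  shows "generate (perm_group (copies G m)) (\<Union>j\<in>J. L_grp G m j) = shift_grp G m J"
proof
  interpret S: group "perm_group (copies G m)" by (rule group_perm_group)
  have "(\<Union>j\<in>J. L_grp G m j) \<subseteq> shift_grp G m J"
    unfolding L_grp_eq_shift_grp shift_grp_def
    by (intro UN_least image_mono) (simp add: supported_mono)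
  then show "generate (perm_group (copies G m)) (\<Union>j\<in>J. L_grp G m j) \<subseteq> shift_grp G m J"
    by (rule S.generate_subgroup_incl [OF _ subgroup_shift_grp])
  show "shift_grp G m J \<subseteq> generate (perm_group (copies G m)) (\<Union>j\<in>J. L_grp G m j)"
    using assms
  proof (induction J)
    case empty
    have "supported G {} = {\<lambda>_. \<one>}"
      by (auto simp: supported_def)
    then show ?case
      by (simp add: shift_grp_def shift_perm_one generate.one del: one_perm_group)
  next
    case (insert j J)
    show ?case
    proof
      fix f assume "f \<in> shift_grp G m (insert j J)"
      then obtain c where c: "c \<in> supported G (insert j J)" "f = shift_perm G m c"
        by (auto simp: shift_grp_def)
      define d where "d = (\<lambda>i. if i = j then \<one> else c i)"
      define e where "e = (\<lambda>i. if i = j then c j else \<one>)"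
      have d: "d \<in> supported G J" and e: "e \<in> supported G {j}"
        using c(1) by (auto simp: supported_def d_def e_def)
      have "(\<lambda>i. d i \<otimes> e i) = c"
        using c(1) by (auto simp: fun_eq_iff supported_def d_def e_def)
      then have "f = shift_perm G m e \<otimes>\<^bsub>perm_group (copies G m)\<^esub> shift_perm G m d"
        by (simp add: shift_perm_mult [OF e d] c(2) del: mult_perm_group)
      moreover have "shift_perm G m e \<in> L_grp G m j"
        using e by (simp add: L_grp_eq_shift_grp shift_grp_def)
      then have "shift_perm G m e \<in> generate (perm_group (copies G m)) (\<Union>j\<in>insert j J. L_grp G m j)"
        by (intro generate.incl) simp
      moreover have "shift_perm G m d \<in> generate (perm_group (copies G m)) (\<Union>j\<in>insert j J. L_grp G m j)"
        using insert.IH d S.mono_generate [of "\<Union>j\<in>J. L_grp G m j" "\<Union>j\<in>insert j J. L_grp G m j"]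
        by (auto simp: shift_grp_def)
      ultimately show "f \<in> generate (perm_group (copies G m)) (\<Union>j\<in>insert j J. L_grp G m j)"
        by (simp add: generate.eng del: mult_perm_group)
    qed
  qed
qed

lemma (in group) shift_grp_Int:
  assumes "I \<subseteq> {1..m}" "I \<inter> J = {}"
  shows "shift_grp G m I \<inter> shift_grp G m J = {\<one>\<^bsub>perm_group (copies G m)\<^esub>}"
proof
  show "{\<one>\<^bsub>perm_group (copies G m)\<^esub>} \<subseteq> shift_grp G m I \<inter> shift_grp G m J"
    using subgroup_shift_grp [THEN subgroup.one_closed] by blast
  show "shift_grp G m I \<inter> shift_grp G m J \<subseteq> {\<one>\<^bsub>perm_group (copies G m)\<^esub>}"
  proof
    fix f assume "f \<in> shift_grp G m I \<inter> shift_grp G m J"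
    then obtain c d where c: "c \<in> supported G I" "f = shift_perm G m c"
      and d: "d \<in> supported G J" "f = shift_perm G m d" by (auto simp: shift_grp_def)
    have "c i = \<one>" for i
    proof (cases "i \<in> I")
      case True
      then have "d i = \<one>" using d(1) assms(2) by (auto simp: supported_def)
      moreover have "c i = d i"
        using shift_perm_apply [of \<one> G i m c] shift_perm_apply [of \<one> G i m d] True assms(1) c d
        by (auto simp: supported_def)
      ultimately show ?thesis by simp
    qed (use c(1) in \<open>simp add: supported_def\<close>)
    then have "c = (\<lambda>_. \<one>)" by blast
    then show "f \<in> {\<one>\<^bsub>perm_group (copies G m)\<^esub>}"
      using c(2) by (simp only: shift_perm_one singleton_iff)
  qed
qed

lemma (in group) shift_grp_normal:
  assumes "J \<subseteq> I"
  shows "shift_grp G m J \<lhd> perm_group (copies G m)\<lparr>carrier := shift_grp G m I\<rparr>"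
proof (rule group.normal_of_exchange [OF group_perm_group subgroup_shift_grp subgroup_shift_grp])
  show "shift_grp G m J \<subseteq> shift_grp G m I"
    unfolding shift_grp_def by (intro image_mono supported_mono assms)
  fix f a assume "f \<in> shift_grp G m I" "a \<in> shift_grp G m J"
  then obtain c d where c: "c \<in> supported G I" "f = shift_perm G m c"
    and d: "d \<in> supported G J" "a = shift_perm G m d" by (auto simp: shift_grp_def)
  \<comment> \<open>Conjugation acts in each coordinate separately, hence it does not enlarge the support.\<close>
  define e where "e = (\<lambda>i. inv (c i) \<otimes> d i \<otimes> c i)"
  have e: "e \<in> supported G J" using c(1) d(1) by (auto simp: supported_def e_def)
  have "(\<lambda>i. c i \<otimes> e i) = (\<lambda>i. d i \<otimes> c i)"
    using c(1) d(1) by (auto simp: supported_def e_def m_assoc [symmetric])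
  then have "f \<otimes>\<^bsub>perm_group (copies G m)\<^esub> a =
      shift_perm G m e \<otimes>\<^bsub>perm_group (copies G m)\<^esub> f"
    by (simp add: c(2) d(2) shift_perm_mult [OF c(1) d(1)] shift_perm_mult [OF e c(1)]
        del: mult_perm_group)
  then show "\<exists>a'\<in>shift_grp G m J. f \<otimes>\<^bsub>perm_group (copies G m)\<^esub> a =
      a' \<otimes>\<^bsub>perm_group (copies G m)\<^esub> f"
    using e by (auto simp: shift_grp_def simp del: mult_perm_group)
qed

lemma (in group) L_grp_internal_direct_family:
  "internal_direct_family (perm_group (copies G m)) {1..m} (L_grp G m) (shift_grp G m {1..m})"
proof -
  have "L_grp G m i \<inter> generate (perm_group (copies G m)) (\<Union>j\<in>{1..m} - {i}. L_grp G m j) =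
      {\<one>\<^bsub>perm_group (copies G m)\<^esub>}" if "i \<in> {1..m}" for i
    unfolding generate_L_grp [OF finite_Diff [OF finite_atLeastAtMost]]
    unfolding L_grp_eq_shift_grp by (rule shift_grp_Int) (use that in auto)
  moreover have "L_grp G m i \<lhd> perm_group (copies G m)\<lparr>carrier := shift_grp G m {1..m}\<rparr>"
    if "i \<in> {1..m}" for i
    using that shift_grp_normal [of "{i}" "{1..m}" m] by (simp add: L_grp_eq_shift_grp)
  ultimately show ?thesis
    by (simp add: internal_direct_family_def subgroup_shift_grp generate_L_grp del: one_perm_group)
qed

section \<open>The complement of the left translations\<close>

lemma (in group) sym_aut_commute:
  assumes "\<sigma> \<in> carrier (sym_group m)" "\<alpha> \<in> carrier (AutoGroup G)"
  shows "sym_perm G m \<sigma> \<otimes>\<^bsub>perm_group (copies G m)\<^esub> aut_perm G m \<alpha> =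
    aut_perm G m \<alpha> \<otimes>\<^bsub>perm_group (copies G m)\<^esub> sym_perm G m \<sigma>"
  by (rule copies_perm_eqI [of _ G m])
    (use sym_group_index [OF assms(1)] automorphism_closed [OF assms(2)] in
      \<open>simp_all add: perm_mult_Bij perm_mult_apply sym_perm_Bij aut_perm_Bij assms
        sym_perm_apply aut_perm_apply del: mult_perm_group atLeastAtMost_iff\<close>)

text \<open>An index permutation fixes all group elements and an automorphism fixes all indices, so the
  two subgroups meet trivially.\<close>

lemma (in group) sym_aut_internal_direct:
  "internal_direct (perm_group (copies G m)) (sym_grp G m) (aut_grp G m)
    (sym_grp G m <#>\<^bsub>perm_group (copies G m)\<^esub> aut_grp G m)"
proof (rule group.internal_directI [OF group_perm_group subgroup_sym_grp subgroup_aut_grp])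
  show "sym_grp G m \<inter> aut_grp G m \<subseteq> {\<one>\<^bsub>perm_group (copies G m)\<^esub>}"
  proof
    fix f assume "f \<in> sym_grp G m \<inter> aut_grp G m"
    then obtain \<sigma> \<alpha> where s: "\<sigma> \<in> carrier (sym_group m)" "f = sym_perm G m \<sigma>"
      and a: "\<alpha> \<in> carrier (AutoGroup G)" "f = aut_perm G m \<alpha>"
      by (auto simp: sym_grp_def aut_grp_def)
    have "f = \<one>\<^bsub>perm_group (copies G m)\<^esub>"
    proof (rule copies_perm_eqI)
      show "f \<in> Bij (copies G m)" using a by (simp add: aut_perm_Bij)
      fix x i assume x: "x \<in> carrier G" "i \<in> {1..m}"
      have "f (x, i) = (x, \<sigma> i)" unfolding s(2) by (rule sym_perm_apply [OF x])
      moreover have "f (x, i) = (\<alpha> x, i)" unfolding a(2) by (rule aut_perm_apply [OF x])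
      ultimately show "f (x, i) = \<one>\<^bsub>perm_group (copies G m)\<^esub> (x, i)"
        using x by simp
    qed (simp add: id_Bij)
    then show "f \<in> {\<one>\<^bsub>perm_group (copies G m)\<^esub>}" by blast
  qed
  fix f h assume "f \<in> sym_grp G m" "h \<in> aut_grp G m"
  then obtain \<sigma> \<alpha> where sa: "\<sigma> \<in> carrier (sym_group m)" "\<alpha> \<in> carrier (AutoGroup G)"
    and fh: "f = sym_perm G m \<sigma>" "h = aut_perm G m \<alpha>"
    unfolding sym_grp_def aut_grp_def by blast
  show "f \<otimes>\<^bsub>perm_group (copies G m)\<^esub> h = h \<otimes>\<^bsub>perm_group (copies G m)\<^esub> f"
    unfolding fh by (rule sym_aut_commute [OF sa])
qed

definition twist_perm ::
    "('a, 'b) monoid_scheme \<Rightarrow> nat \<Rightarrow> (nat \<Rightarrow> nat) \<Rightarrow> ('a \<Rightarrow> 'a) \<Rightarrow> 'a \<times> nat \<Rightarrow> 'a \<times> nat" where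
  "twist_perm G m \<sigma> \<alpha> = sym_perm G m \<sigma> \<otimes>\<^bsub>perm_group (copies G m)\<^esub> aut_perm G m \<alpha>"

lemma mem_sym_aut_product:
  "f \<in> sym_grp G m <#>\<^bsub>perm_group (copies G m)\<^esub> aut_grp G m \<longleftrightarrow>
    (\<exists>\<sigma>\<in>carrier (sym_group m). \<exists>\<alpha>\<in>carrier (AutoGroup G). f = twist_perm G m \<sigma> \<alpha>)"
  by (simp add: mem_set_mult sym_grp_def aut_grp_def twist_perm_def del: mult_perm_group)

lemma twist_perm_Bij:
  assumes "\<sigma> \<in> carrier (sym_group m)" "\<alpha> \<in> carrier (AutoGroup G)"
  shows "twist_perm G m \<sigma> \<alpha> \<in> Bij (copies G m)"
  unfolding twist_perm_def by (intro perm_mult_Bij sym_perm_Bij aut_perm_Bij assms)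

lemma twist_perm_apply:
  assumes "\<sigma> \<in> carrier (sym_group m)" "\<alpha> \<in> carrier (AutoGroup G)" "x \<in> carrier G" "i \<in> {1..m}"
  shows "twist_perm G m \<sigma> \<alpha> (x, i) = (\<alpha> x, \<sigma> i)"
  using assms sym_group_index [OF assms(1,4)]
  by (simp add: twist_perm_def perm_mult_apply sym_perm_Bij aut_perm_Bij sym_perm_apply
      aut_perm_apply del: mult_perm_group atLeastAtMost_iff)

text \<open>The point \<open>(x, i)\<close> is first sent to \<open>(\<alpha> x, \<sigma> i)\<close> and then translated by \<open>d (\<sigma> i)\<close>. Translating
  first by the preimage \<open>e i\<close> of \<open>d (\<sigma> i)\<close> under \<open>\<alpha>\<close> has the same effect.\<close>

lemma (in group) twist_shift_exchange:
  assumes s: "\<sigma> \<in> carrier (sym_group m)" and a: "\<alpha> \<in> carrier (AutoGroup G)"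
    and d: "d \<in> supported G {1..m}"
  shows "\<exists>e\<in>supported G {1..m}.
    twist_perm G m \<sigma> \<alpha> \<otimes>\<^bsub>perm_group (copies G m)\<^esub> shift_perm G m d =
    shift_perm G m e \<otimes>\<^bsub>perm_group (copies G m)\<^esub> twist_perm G m \<sigma> \<alpha>"
proof -
  have "\<exists>x. x \<in> carrier G \<and> \<alpha> x = d (\<sigma> i)" for i
    by (rule automorphism_surj [OF a]) (use d in \<open>simp add: supported_def\<close>)
  then have "\<exists>e. \<forall>i. e i \<in> carrier G \<and> \<alpha> (e i) = d (\<sigma> i)" by (intro choice allI)
  then obtain e0 where e0: "\<And>i. e0 i \<in> carrier G \<and> \<alpha> (e0 i) = d (\<sigma> i)" by blast
  define e where "e = (\<lambda>i. if i \<in> {1..m} then e0 i else \<one>)"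
  have e: "e \<in> supported G {1..m}" using e0 by (auto simp: supported_def e_def)
  have eC: "e i \<in> carrier G" for i using e by (simp add: supported_def)
  have "twist_perm G m \<sigma> \<alpha> \<otimes>\<^bsub>perm_group (copies G m)\<^esub> shift_perm G m d =
    shift_perm G m e \<otimes>\<^bsub>perm_group (copies G m)\<^esub> twist_perm G m \<sigma> \<alpha>"
  proof (rule copies_perm_eqI)
    fix x i assume x: "x \<in> carrier G" "i \<in> {1..m}"
    have "\<alpha> (e i \<otimes> x) = d (\<sigma> i) \<otimes> \<alpha> x"
      using automorphism_mult [OF a, of "e i" x] x e0 [of i] by (simp add: e_def)
    then show "(twist_perm G m \<sigma> \<alpha> \<otimes>\<^bsub>perm_group (copies G m)\<^esub> shift_perm G m d) (x, i) =
        (shift_perm G m e \<otimes>\<^bsub>perm_group (copies G m)\<^esub> twist_perm G m \<sigma> \<alpha>) (x, i)"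
      using x eC sym_group_index [OF s x(2)] automorphism_closed [OF a x(1)]
      by (simp add: perm_mult_apply twist_perm_Bij [OF s a] shift_perm_Bij [OF d]
          shift_perm_Bij [OF e] twist_perm_apply [OF s a] shift_perm_apply
          del: mult_perm_group atLeastAtMost_iff)
  qed (intro perm_mult_Bij twist_perm_Bij [OF s a] shift_perm_Bij [OF d] shift_perm_Bij [OF e])+
  with e show ?thesis by (intro bexI)
qed

text \<open>The intersection is trivial because a twist sends \<open>(1, i)\<close> to \<open>(1, \<sigma> i)\<close>, whereas the
  translation by \<open>c\<close> sends it to \<open>(c i, i)\<close>.\<close>

lemma (in group) shift_twist_internal_semidirect:
  "internal_semidirect (perm_group (copies G m)) (shift_grp G m {1..m})
    (sym_grp G m <#>\<^bsub>perm_group (copies G m)\<^esub> aut_grp G m)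
    (shift_grp G m {1..m} <#>\<^bsub>perm_group (copies G m)\<^esub>
      (sym_grp G m <#>\<^bsub>perm_group (copies G m)\<^esub> aut_grp G m))"
proof (rule group.internal_semidirectI [OF group_perm_group subgroup_shift_grp])
  show "subgroup (sym_grp G m <#>\<^bsub>perm_group (copies G m)\<^esub> aut_grp G m) (perm_group (copies G m))"
    using sym_aut_internal_direct by (simp add: internal_direct_def)
  show "shift_grp G m {1..m} \<inter> (sym_grp G m <#>\<^bsub>perm_group (copies G m)\<^esub> aut_grp G m)
      \<subseteq> {\<one>\<^bsub>perm_group (copies G m)\<^esub>}"
  proof
    fix f assume "f \<in> shift_grp G m {1..m} \<inter> (sym_grp G m <#>\<^bsub>perm_group (copies G m)\<^esub> aut_grp G m)"
    then have f1: "f \<in> shift_grp G m {1..m}"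
      and f2: "f \<in> sym_grp G m <#>\<^bsub>perm_group (copies G m)\<^esub> aut_grp G m" by simp_all
    obtain c where c: "c \<in> supported G {1..m}" "f = shift_perm G m c"
      using f1 by (auto simp: shift_grp_def)
    obtain \<sigma> \<alpha> where s: "\<sigma> \<in> carrier (sym_group m)" and a: "\<alpha> \<in> carrier (AutoGroup G)"
      and f: "f = twist_perm G m \<sigma> \<alpha>"
      using f2 unfolding mem_sym_aut_product by (elim bexE)
    have "c i = \<one>" for i
    proof (cases "i \<in> {1..m}")
      case True
      have "f (\<one>, i) = (c i \<otimes> \<one>, i)"
        unfolding c(2) by (rule shift_perm_apply [OF one_closed True])
      moreover have "f (\<one>, i) = (\<alpha> \<one>, \<sigma> i)"
        unfolding f by (rule twist_perm_apply [OF s a one_closed True])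
      ultimately show ?thesis using c(1) automorphism_one [OF a] by (simp add: supported_def)
    qed (use c(1) in \<open>simp add: supported_def\<close>)
    then have "c = (\<lambda>_. \<one>)" by blast
    then show "f \<in> {\<one>\<^bsub>perm_group (copies G m)\<^esub>}"
      using c(2) by (simp only: shift_perm_one singleton_iff)
  qed
  fix l k assume lk: "l \<in> shift_grp G m {1..m}"
    "k \<in> sym_grp G m <#>\<^bsub>perm_group (copies G m)\<^esub> aut_grp G m"
  obtain d where d: "d \<in> supported G {1..m}" "l = shift_perm G m d"
    using lk(1) by (auto simp: shift_grp_def)
  obtain \<sigma> \<alpha> where k: "\<sigma> \<in> carrier (sym_group m)" "\<alpha> \<in> carrier (AutoGroup G)"
    "k = twist_perm G m \<sigma> \<alpha>"
    using lk(2) unfolding mem_sym_aut_product by (elim bexE)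
  show "\<exists>l'\<in>shift_grp G m {1..m}. k \<otimes>\<^bsub>perm_group (copies G m)\<^esub> l =
      l' \<otimes>\<^bsub>perm_group (copies G m)\<^esub> k"
    using twist_shift_exchange [OF k(1,2) d(1)]
    by (simp add: shift_grp_def d(2) k(3) del: mult_perm_group)
qed

section \<open>The normalizer of the right regular action\<close>

text \<open>The hypothesis is the identity \<open>R(g) f = f R(\<alpha> g)\<close>, read pointwise. It puts \<open>f\<close> into the
  normalizer rather than merely giving one inclusion of cosets because \<open>\<alpha>\<close> is onto.\<close>

lemma (in group) mem_normalizer_R_grpI:
  assumes f: "f \<in> Bij (copies G m)" and a: "\<alpha> \<in> carrier (AutoGroup G)"
    and eq: "\<And>x g i. x \<in> carrier G \<Longrightarrow> g \<in> carrier G \<Longrightarrow> i \<in> {1..m} \<Longrightarrow>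
      f (x \<otimes> g, i) = R_perm G m (\<alpha> g) (f (x, i))"
  shows "f \<in> normalizer (perm_group (copies G m)) (R_grp G m)"
proof -
  let ?S = "perm_group (copies G m)"
  have R: "R_perm G m g \<in> Bij (copies G m)" if "g \<in> carrier G" for g
    by (rule R_perm_Bij [OF is_group that])
  have ex: "R_perm G m g \<otimes>\<^bsub>?S\<^esub> f = f \<otimes>\<^bsub>?S\<^esub> R_perm G m (\<alpha> g)" if g: "g \<in> carrier G" for g
    by (rule copies_perm_eqI [of _ G m])
      (use f g R automorphism_closed [OF a g] eq in
        \<open>simp_all add: perm_mult_Bij perm_mult_apply R_perm_apply del: mult_perm_group atLeastAtMost_iff\<close>)
  have "\<alpha> ` carrier G = carrier G"
    using a by (auto simp: carrier_AutoGroup Bij_def bij_betw_def)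
  then have "R_grp G m = R_perm G m ` \<alpha> ` carrier G" by (simp add: R_grp_def)
  then have "f <#\<^bsub>?S\<^esub> R_grp G m = (\<Union>g\<in>carrier G. {f \<otimes>\<^bsub>?S\<^esub> R_perm G m (\<alpha> g)})"
    by (simp add: l_coset_def del: mult_perm_group)
  also have "\<dots> = R_grp G m #>\<^bsub>?S\<^esub> f"
    by (simp add: r_coset_def R_grp_def ex del: mult_perm_group)
  finally show ?thesis
    using f R by (subst group.mem_normalizer_iff [OF group_perm_group])
      (auto simp: R_grp_def simp del: mult_perm_group)
qed

lemma (in group) shift_twist_mem_normalizer:
  assumes c: "c \<in> supported G {1..m}" and s: "\<sigma> \<in> carrier (sym_group m)"
    and a: "\<alpha> \<in> carrier (AutoGroup G)"
  shows "shift_perm G m c \<otimes>\<^bsub>perm_group (copies G m)\<^esub> twist_perm G m \<sigma> \<alpha>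
    \<in> normalizer (perm_group (copies G m)) (R_grp G m)"
proof (rule mem_normalizer_R_grpI [OF _ a])
  have cC: "c i \<in> carrier G" for i using c by (simp add: supported_def)
  show "shift_perm G m c \<otimes>\<^bsub>perm_group (copies G m)\<^esub> twist_perm G m \<sigma> \<alpha> \<in> Bij (copies G m)"
    by (intro perm_mult_Bij shift_perm_Bij [OF c] twist_perm_Bij s a)
  fix x g i assume x: "x \<in> carrier G" "g \<in> carrier G" "i \<in> {1..m}"
  then show "(shift_perm G m c \<otimes>\<^bsub>perm_group (copies G m)\<^esub> twist_perm G m \<sigma> \<alpha>) (x \<otimes> g, i) =
      R_perm G m (\<alpha> g) ((shift_perm G m c \<otimes>\<^bsub>perm_group (copies G m)\<^esub> twist_perm G m \<sigma> \<alpha>) (x, i))"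
    using cC sym_group_index [OF s x(3)] automorphism_closed [OF a]
    by (simp add: perm_mult_apply shift_perm_Bij [OF c] twist_perm_Bij [OF s a] shift_perm_apply
        twist_perm_apply [OF s a] R_perm_apply automorphism_mult [OF a] m_assoc
        del: mult_perm_group atLeastAtMost_iff)
qed

text \<open>The map \<open>\<beta>\<close> exists since \<open>R f \<subseteq> f R\<close>, and it is onto since \<open>f R \<subseteq> R f\<close>. The right translations
  act regularly on each copy, so following the orbit of the single point \<open>(1, 1)\<close> determines \<open>\<beta>\<close>
  and yields the homomorphism law and injectivity.\<close>

lemma (in group) normalizer_R_grp_intertwines:
  assumes m: "m \<ge> 1" and N: "f \<in> normalizer (perm_group (copies G m)) (R_grp G m)"
  obtains \<alpha> where "f \<in> Bij (copies G m)" "\<alpha> \<in> carrier (AutoGroup G)"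
    "\<And>x g i. x \<in> carrier G \<Longrightarrow> g \<in> carrier G \<Longrightarrow> i \<in> {1..m} \<Longrightarrow>
      f (x \<otimes> g, i) = R_perm G m (\<alpha> g) (f (x, i))"
proof -
  let ?S = "perm_group (copies G m)"
  have R: "R_perm G m g \<in> Bij (copies G m)" if "g \<in> carrier G" for g
    by (rule R_perm_Bij [OF is_group that])
  have "R_grp G m \<subseteq> carrier ?S" using R by (auto simp: R_grp_def)
  then have f: "f \<in> Bij (copies G m)" and coset: "f <#\<^bsub>?S\<^esub> R_grp G m = R_grp G m #>\<^bsub>?S\<^esub> f"
    using N by (simp_all add: group.mem_normalizer_iff [OF group_perm_group])
  have fV: "f v \<in> copies G m" if "v \<in> copies G m" for v
    using Bij_imp_funcset [OF f] that by blast
  have ev1: "f (x \<otimes> g, i) = R_perm G m h (f (x, i))"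
    if "R_perm G m g \<otimes>\<^bsub>?S\<^esub> f = f \<otimes>\<^bsub>?S\<^esub> R_perm G m h"
      "g \<in> carrier G" "h \<in> carrier G" "x \<in> carrier G" "i \<in> {1..m}" for g h x i
    using fun_cong [OF that(1), of "(x, i)"] that(2-) f R
    by (simp add: perm_mult_apply R_perm_apply del: mult_perm_group)
  have "\<exists>h. h \<in> carrier G \<and> R_perm G m g \<otimes>\<^bsub>?S\<^esub> f = f \<otimes>\<^bsub>?S\<^esub> R_perm G m h"
    if "g \<in> carrier G" for g
  proof -
    have "R_perm G m g \<otimes>\<^bsub>?S\<^esub> f \<in> f <#\<^bsub>?S\<^esub> R_grp G m"
      unfolding coset using that by (auto simp: r_coset_def R_grp_def simp del: mult_perm_group)
    then show ?thesis by (auto simp: l_coset_def R_grp_def simp del: mult_perm_group)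
  qed
  then obtain \<beta> where \<beta>: "\<And>g. g \<in> carrier G \<Longrightarrow> \<beta> g \<in> carrier G \<and>
      R_perm G m g \<otimes>\<^bsub>?S\<^esub> f = f \<otimes>\<^bsub>?S\<^esub> R_perm G m (\<beta> g)" by metis
  have conj: "\<exists>g. g \<in> carrier G \<and> R_perm G m g \<otimes>\<^bsub>?S\<^esub> f = f \<otimes>\<^bsub>?S\<^esub> R_perm G m h"
    if "h \<in> carrier G" for h
  proof -
    have "f \<otimes>\<^bsub>?S\<^esub> R_perm G m h \<in> R_grp G m #>\<^bsub>?S\<^esub> f"
      unfolding coset [symmetric] using that
      by (auto simp: l_coset_def R_grp_def simp del: mult_perm_group)
    then show ?thesis by (auto simp: r_coset_def R_grp_def simp del: mult_perm_group)
  qed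
  have eq: "f (x \<otimes> g, i) = R_perm G m (\<beta> g) (f (x, i))"
    if "x \<in> carrier G" "g \<in> carrier G" "i \<in> {1..m}" for x g i
    using ev1 \<beta> that by blast
  obtain p j where pj: "f (\<one>, 1) = (p, j)" by force
  then have p: "p \<in> carrier G" "j \<in> {1..m}"
    using fV [of "(\<one>, 1)"] m by (simp_all add: copies_def)
  have one: "f (g, 1) = (p \<otimes> \<beta> g, j)" if "g \<in> carrier G" for g
    using eq [of \<one> g 1] that m p by (simp add: pj [unfolded One_nat_def] R_perm_apply)
  have mult: "\<beta> (g \<otimes> h) = \<beta> g \<otimes> \<beta> h" if g: "g \<in> carrier G" "h \<in> carrier G" for g h
  proof -
    have "(p \<otimes> \<beta> (g \<otimes> h), j) = R_perm G m (\<beta> h) (p \<otimes> \<beta> g, j)"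
      using eq [of g h 1] one g m by simp
    then have "p \<otimes> \<beta> (g \<otimes> h) = p \<otimes> (\<beta> g \<otimes> \<beta> h)"
      using p \<beta> g by (simp add: R_perm_apply m_assoc)
    then show ?thesis using p \<beta> g by simp
  qed
  have inj: "inj_on \<beta> (carrier G)"
  proof (rule inj_onI)
    fix g h assume gh: "g \<in> carrier G" "h \<in> carrier G" "\<beta> g = \<beta> h"
    then have "f (g, 1) = f (h, 1)" using one [OF gh(1)] one [OF gh(2)] by simp
    moreover have "inj_on f (copies G m)" using f by (simp add: Bij_def bij_betw_def)
    ultimately have "(g, 1::nat) = (h, 1)" using gh m by (auto dest!: inj_onD)
    then show "g = h" by simp
  qed
  have surj: "\<beta> ` carrier G = carrier G"
  proof
    show "\<beta> ` carrier G \<subseteq> carrier G" using \<beta> by blast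
    show "carrier G \<subseteq> \<beta> ` carrier G"
    proof
      fix h assume h: "h \<in> carrier G"
      then obtain g where g: "g \<in> carrier G"
        "R_perm G m g \<otimes>\<^bsub>?S\<^esub> f = f \<otimes>\<^bsub>?S\<^esub> R_perm G m h" using conj by blast
      then have "f (g, 1) = (p \<otimes> h, j)"
        using ev1 [OF g(2) g(1) h one_closed, of 1] m p
        by (simp add: pj [unfolded One_nat_def] R_perm_apply)
      then have "\<beta> g = h" using one g(1) \<beta> p h by simp
      then show "h \<in> \<beta> ` carrier G" using g(1) by blast
    qed
  qed
  \<comment> \<open>Elements of \<open>AutoGroup\<close> are extensional functions.\<close>
  define \<alpha> where "\<alpha> = restrict \<beta> (carrier G)"
  have "\<alpha> \<in> Bij (carrier G)"
    using inj surj by (simp add: \<alpha>_def Bij_def bij_betw_def)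
  moreover have "\<alpha> \<in> hom G G"
    using mult \<beta> by (auto simp: \<alpha>_def hom_def)
  ultimately have "\<alpha> \<in> carrier (AutoGroup G)" by (simp add: carrier_AutoGroup)
  with f eq show ?thesis using that by (simp add: \<alpha>_def)
qed

text \<open>Since \<open>(x, i)\<close> is the right translate of \<open>(1, i)\<close> by \<open>x\<close>, the intertwining identity gives
  \<open>f (x, i) = (p i \<otimes> \<alpha> x, \<tau> i)\<close> with \<open>(p i, \<tau> i) = f (1, i)\<close>.\<close>

lemma (in group) normalizer_R_grp_decomposition:
  assumes m: "m \<ge> 1" and N: "f \<in> normalizer (perm_group (copies G m)) (R_grp G m)"
  shows "\<exists>c\<in>supported G {1..m}. \<exists>\<sigma>\<in>carrier (sym_group m). \<exists>\<alpha>\<in>carrier (AutoGroup G).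
    f = shift_perm G m c \<otimes>\<^bsub>perm_group (copies G m)\<^esub> twist_perm G m \<sigma> \<alpha>"
proof -
  obtain \<alpha> where f: "f \<in> Bij (copies G m)" and a: "\<alpha> \<in> carrier (AutoGroup G)"
    and eq: "\<And>x g i. x \<in> carrier G \<Longrightarrow> g \<in> carrier G \<Longrightarrow> i \<in> {1..m} \<Longrightarrow>
      f (x \<otimes> g, i) = R_perm G m (\<alpha> g) (f (x, i))"
    using normalizer_R_grp_intertwines [OF m N] by blast
  have fV: "f v \<in> copies G m" if "v \<in> copies G m" for v
    using Bij_imp_funcset [OF f] that by blast
  define p where "p = (\<lambda>i. fst (f (\<one>, i)))"
  define \<tau> where "\<tau> = (\<lambda>i. snd (f (\<one>, i)))"
  have p: "p i \<in> carrier G" "\<tau> i \<in> {1..m}" if "i \<in> {1..m}" for i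
    using fV [of "(\<one>, i)"] that by (auto simp: p_def \<tau>_def copies_def mem_Times_iff)
  have fx: "f (x, i) = (p i \<otimes> \<alpha> x, \<tau> i)" if x: "x \<in> carrier G" "i \<in> {1..m}" for x i
  proof -
    have "f (\<one>, i) = (p i, \<tau> i)" by (simp add: p_def \<tau>_def)
    then show ?thesis
      using eq [of \<one> x i] x p [OF x(2)] by (simp add: R_perm_apply del: atLeastAtMost_iff)
  qed
  have "f ` copies G m = copies G m" using f by (simp add: Bij_def bij_betw_def)
  have surj: "\<tau> ` {1..m} = {1..m}"
  proof
    show "\<tau> ` {1..m} \<subseteq> {1..m}" using p by blast
    show "{1..m} \<subseteq> \<tau> ` {1..m}"
    proof
      fix j assume "j \<in> {1..m}"
      then have "(\<one>, j) \<in> f ` copies G m" using \<open>f ` copies G m = copies G m\<close> by simp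
      then obtain x i where "x \<in> carrier G" "i \<in> {1..m}" "f (x, i) = (\<one>, j)"
        by (auto simp: copies_def)
      then show "j \<in> \<tau> ` {1..m}" using fx by auto
    qed
  qed
  then have bij: "bij_betw \<tau> {1..m} {1..m}"
    by (simp add: bij_betw_def eq_card_imp_inj_on)
  \<comment> \<open>Elements of \<open>sym_group m\<close> fix all numbers outside \<open>{1..m}\<close>.\<close>
  define \<sigma> where "\<sigma> = (\<lambda>i. if i \<in> {1..m} then \<tau> i else i)"
  have "bij_betw \<sigma> {1..m} {1..m}"
    using bij by (rule bij_betw_cong [THEN iffD1, rotated]) (simp add: \<sigma>_def)
  then have s: "\<sigma> \<in> carrier (sym_group m)"
    unfolding sym_group_carrier by (rule bij_imp_permutes) (simp only: \<sigma>_def if_False)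
  \<comment> \<open>The translation is performed before the automorphism, so it must use \<open>\<alpha>\<^sup>-\<^sup>1 (p i)\<close>.\<close>
  have "\<forall>i\<in>{1..m}. \<exists>y. y \<in> carrier G \<and> \<alpha> y = p i"
    using automorphism_surj [OF a] p by blast
  then obtain c0 where c0: "\<And>i. i \<in> {1..m} \<Longrightarrow> c0 i \<in> carrier G \<and> \<alpha> (c0 i) = p i"
    using bchoice [of "{1..m}" "\<lambda>i y. y \<in> carrier G \<and> \<alpha> y = p i"] by blast
  define c where "c = (\<lambda>i. if i \<in> {1..m} then c0 i else \<one>)"
  have c: "c \<in> supported G {1..m}" using c0 by (auto simp: supported_def c_def)
  have "f = shift_perm G m c \<otimes>\<^bsub>perm_group (copies G m)\<^esub> twist_perm G m \<sigma> \<alpha>"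
  proof (rule copies_perm_eqI [OF f])
    show "shift_perm G m c \<otimes>\<^bsub>perm_group (copies G m)\<^esub> twist_perm G m \<sigma> \<alpha> \<in> Bij (copies G m)"
      by (intro perm_mult_Bij shift_perm_Bij [OF c] twist_perm_Bij s a)
    fix x i assume x: "x \<in> carrier G" "i \<in> {1..m}"
    then have ci: "c i \<in> carrier G" "\<alpha> (c i) = p i" "\<sigma> i = \<tau> i"
      using c0 by (auto simp: c_def \<sigma>_def)
    then show "f (x, i) =
        (shift_perm G m c \<otimes>\<^bsub>perm_group (copies G m)\<^esub> twist_perm G m \<sigma> \<alpha>) (x, i)"
      using x by (simp add: perm_mult_apply shift_perm_Bij [OF c] twist_perm_Bij [OF s a]
          shift_perm_apply twist_perm_apply [OF s a] automorphism_mult [OF a] fx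
          del: mult_perm_group atLeastAtMost_iff)
  qed
  with c s a show ?thesis by (intro bexI)
qed

lemma (in group) normalizer_R_grp:
  assumes "m \<ge> 1"
  shows "normalizer (perm_group (copies G m)) (R_grp G m) =
    shift_grp G m {1..m} <#>\<^bsub>perm_group (copies G m)\<^esub>
      (sym_grp G m <#>\<^bsub>perm_group (copies G m)\<^esub> aut_grp G m)" (is "?N = ?P")
proof
  show "?N \<subseteq> ?P"
  proof
    fix f assume "f \<in> ?N"
    from normalizer_R_grp_decomposition [OF assms this] obtain c \<sigma> \<alpha>
      where c: "c \<in> supported G {1..m}"
        and k: "\<sigma> \<in> carrier (sym_group m)" "\<alpha> \<in> carrier (AutoGroup G)"
        and f: "f = shift_perm G m c \<otimes>\<^bsub>perm_group (copies G m)\<^esub> twist_perm G m \<sigma> \<alpha>"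
      by (elim bexE)
    have "shift_perm G m c \<in> shift_grp G m {1..m}"
      unfolding shift_grp_def by (rule imageI [OF c])
    moreover have "twist_perm G m \<sigma> \<alpha> \<in> sym_grp G m <#>\<^bsub>perm_group (copies G m)\<^esub> aut_grp G m"
      unfolding mem_sym_aut_product by (intro bexI [OF _ k(1)] bexI [OF _ k(2)] refl)
    ultimately show "f \<in> ?P"
      using f unfolding mem_set_mult [of f] by (intro bexI)
  qed
  show "?P \<subseteq> ?N"
  proof
    fix f assume "f \<in> ?P"
    then obtain l k where l: "l \<in> shift_grp G m {1..m}"
      and k: "k \<in> sym_grp G m <#>\<^bsub>perm_group (copies G m)\<^esub> aut_grp G m"
      and f: "f = l \<otimes>\<^bsub>perm_group (copies G m)\<^esub> k"
      unfolding mem_set_mult [of f] by (elim bexE)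
    obtain c where c: "c \<in> supported G {1..m}" "l = shift_perm G m c"
      using l by (auto simp: shift_grp_def)
    obtain \<sigma> \<alpha> where "\<sigma> \<in> carrier (sym_group m)" "\<alpha> \<in> carrier (AutoGroup G)"
      "k = twist_perm G m \<sigma> \<alpha>"
      using k unfolding mem_sym_aut_product by (elim bexE)
    with c f show "f \<in> ?N" by (simp only: shift_twist_mem_normalizer)
  qed
qed

theorem theorem2p3:
  fixes G :: "('a, 'b) monoid_scheme" and m :: nat
  assumes "group G" and "finite (carrier G)" and "m \<ge> 1"
  shows "\<exists>L K. internal_direct_family (perm_group (copies G m)) {1..m} (L_grp G m) L \<and>
               internal_direct (perm_group (copies G m)) (sym_grp G m) (aut_grp G m) K \<and>
               internal_semidirect (perm_group (copies G m)) L K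
                 (normalizer (perm_group (copies G m)) (R_grp G m))"
proof -
  interpret group G by fact
  show ?thesis
    unfolding normalizer_R_grp [OF assms(3)]
    using L_grp_internal_direct_family sym_aut_internal_direct shift_twist_internal_semidirect
    by blast
qed

end
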